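(* Let $(\mathcal{M}, g, A)$ be an almost Hermitian manifold with K\"ahler form $F(X,Y)=g(AX,Y)$ and generalized Riemannian metric $G=g+F$. Let $\pi$ be a 1-form on $\mathcal{M}$ and let $\overset{1}{\nabla}$ be the quarter-symmetric connection $\overset{1}{\nabla}_X Y=\overset{g}{\nabla}_X Y-\pi(X)AY$. If $\overset{1}{\nabla}$ preserves $G$, i.e. $\overset{1}{\nabla}G=0$, then $(\mathcal{M},g,A)$ is a K\"ahler manifold.
   Context: An almost Hermitian manifold $(\mathcal{M},g,A)$ is a Riemannian manifold $(\mathcal{M},g)$ of dimension $n=2k\ge 4$ with a $(1,1)$ tensor field $A$ satisfying $A^2=-I$ and $g(AX,AY)=g(X,Y)$. $\overset{g}{\nabla}$ denotes the Levi-Civita connection of $g$. An almost Hermitian manifold is called K\"ahler if $\overset{g}{\nabla}A=0$. $F$ is the skew-symmetric $(0,2)$ tensor $F(X,Y)=g(AX,Y)$, and $G=g+F$ is a (non-symmetric) $(0,2)$ tensor. The 1-form $\pi$ is called the generator of the connection $\overset{1}{\nabla}$. *)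

theory Defs
  imports "HOL-Analysis.Analysis"
begin

text \<open>
  A manifold is a type \<open>'m\<close> carrying a Hausdorff, second countable topology, together with
  a smooth atlas modelled on a Euclidean space \<open>'e\<close>.  The atlas need not be maximal; it
  determines the smooth structure.
\<close>

text \<open>Only used for open \<open>S\<close>, where the Frechet derivative is unique.\<close>

primrec Ck_on :: "nat \<Rightarrow> 'e::euclidean_space set \<Rightarrow> ('e \<Rightarrow> 'f::real_normed_vector) \<Rightarrow> bool" where
  "Ck_on 0 S f \<longleftrightarrow> continuous_on S f"
| "Ck_on (Suc k) S f \<longleftrightarrow>
     f differentiable_on S \<and> (\<forall>v. Ck_on k S (\<lambda>x. frechet_derivative f (at x) v))"

definition smooth_on :: "'e::euclidean_space set \<Rightarrow> ('e \<Rightarrow> 'f::real_normed_vector) \<Rightarrow> bool" where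
  "smooth_on S f \<longleftrightarrow> (\<forall>k. Ck_on k S f)"

type_synonym ('m, 'e) atlas = "('m set \<times> ('m \<Rightarrow> 'e)) set"

definition smooth_manifold ::
    "('m::{t2_space, second_countable_topology}, 'e::euclidean_space) atlas \<Rightarrow> bool" where
  "smooth_manifold \<A> \<longleftrightarrow>
     (\<forall>(U, \<phi>) \<in> \<A>. open U \<and> open (\<phi> ` U) \<and> homeomorphism U (\<phi> ` U) \<phi> (inv_into U \<phi>)) \<and>
     (\<Union>(U, \<phi>) \<in> \<A>. U) = UNIV \<and>
     (\<forall>(U, \<phi>) \<in> \<A>. \<forall>(V, \<psi>) \<in> \<A>. smooth_on (\<phi> ` (U \<inter> V)) (\<psi> \<circ> inv_into U \<phi>))"

definition smooth_functions ::
    "('m::{t2_space, second_countable_topology}, 'e::euclidean_space) atlas \<Rightarrow> ('m \<Rightarrow> real) set" where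
  "smooth_functions \<A> = {f. \<forall>(U, \<phi>) \<in> \<A>. smooth_on (\<phi> ` U) (f \<circ> inv_into U \<phi>)}"

text \<open>
  Tangent vectors at \<open>p\<close> are derivations at \<open>p\<close> of the algebra of smooth functions.  A
  derivation is represented by a total function on \<open>'m \<Rightarrow> real\<close>; it takes the value 0 on
  non-smooth arguments, so that equality of representatives is equality of tangent vectors.
\<close>

type_synonym 'm tvec = "('m \<Rightarrow> real) \<Rightarrow> real"
type_synonym 'm vfield = "'m \<Rightarrow> 'm tvec"

definition tangent_space ::
    "('m::{t2_space, second_countable_topology}, 'e::euclidean_space) atlas \<Rightarrow> 'm \<Rightarrow> 'm tvec set" where
  "tangent_space \<A> p = {v.
     (\<forall>f. f \<notin> smooth_functions \<A> \<longrightarrow> v f = 0) \<and>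
     (\<forall>f \<in> smooth_functions \<A>. \<forall>h \<in> smooth_functions \<A>. \<forall>a b.
        v (\<lambda>x. a * f x + b * h x) = a * v f + b * v h) \<and>
     (\<forall>f \<in> smooth_functions \<A>. \<forall>h \<in> smooth_functions \<A>.
        v (\<lambda>x. f x * h x) = f p * v h + h p * v f)}"

definition tlincomb :: "real \<Rightarrow> 'm tvec \<Rightarrow> real \<Rightarrow> 'm tvec \<Rightarrow> 'm tvec" where
  "tlincomb a v b w = (\<lambda>f. a * v f + b * w f)"

definition vector_fields ::
    "('m::{t2_space, second_countable_topology}, 'e::euclidean_space) atlas \<Rightarrow> 'm vfield set" where
  "vector_fields \<A> = {X. (\<forall>p. X p \<in> tangent_space \<A> p) \<and>
     (\<forall>f \<in> smooth_functions \<A>. (\<lambda>p. X p f) \<in> smooth_functions \<A>)}"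

definition vf_add :: "'m vfield \<Rightarrow> 'm vfield \<Rightarrow> 'm vfield" where
  "vf_add X Y = (\<lambda>p f. X p f + Y p f)"

definition vf_scale :: "('m \<Rightarrow> real) \<Rightarrow> 'm vfield \<Rightarrow> 'm vfield" where
  "vf_scale h X = (\<lambda>p f. h p * X p f)"

definition lie_bracket :: "'m vfield \<Rightarrow> 'm vfield \<Rightarrow> 'm vfield" where
  "lie_bracket X Y = (\<lambda>p f. X p (\<lambda>q. Y q f) - Y p (\<lambda>q. X q f))"

text \<open>
  Tensor fields are families of multilinear maps on the tangent spaces, smooth in the sense
  that they take smooth vector fields to smooth functions or vector fields.
\<close>

type_synonym 'm form1 = "'m \<Rightarrow> 'm tvec \<Rightarrow> real"
type_synonym 'm tensor02 = "'m \<Rightarrow> 'm tvec \<Rightarrow> 'm tvec \<Rightarrow> real"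
type_synonym 'm tensor11 = "'m \<Rightarrow> 'm tvec \<Rightarrow> 'm tvec"

definition one_form ::
    "('m::{t2_space, second_countable_topology}, 'e::euclidean_space) atlas \<Rightarrow> 'm form1 \<Rightarrow> bool" where
  "one_form \<A> \<pi> \<longleftrightarrow>
     (\<forall>p. \<forall>v \<in> tangent_space \<A> p. \<forall>w \<in> tangent_space \<A> p. \<forall>a b.
        \<pi> p (tlincomb a v b w) = a * \<pi> p v + b * \<pi> p w) \<and>
     (\<forall>X \<in> vector_fields \<A>. (\<lambda>p. \<pi> p (X p)) \<in> smooth_functions \<A>)"

definition tensor_field02 ::
    "('m::{t2_space, second_countable_topology}, 'e::euclidean_space) atlas \<Rightarrow> 'm tensor02 \<Rightarrow> bool" where
  "tensor_field02 \<A> T \<longleftrightarrow>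
     (\<forall>p. \<forall>u \<in> tangent_space \<A> p. \<forall>v \<in> tangent_space \<A> p. \<forall>w \<in> tangent_space \<A> p. \<forall>a b.
        T p (tlincomb a u b v) w = a * T p u w + b * T p v w \<and>
        T p w (tlincomb a u b v) = a * T p w u + b * T p w v) \<and>
     (\<forall>X \<in> vector_fields \<A>. \<forall>Y \<in> vector_fields \<A>. (\<lambda>p. T p (X p) (Y p)) \<in> smooth_functions \<A>)"

definition tensor_field11 ::
    "('m::{t2_space, second_countable_topology}, 'e::euclidean_space) atlas \<Rightarrow> 'm tensor11 \<Rightarrow> bool" where
  "tensor_field11 \<A> A \<longleftrightarrow>
     (\<forall>p. \<forall>v \<in> tangent_space \<A> p. A p v \<in> tangent_space \<A> p) \<and>
     (\<forall>p. \<forall>v \<in> tangent_space \<A> p. \<forall>w \<in> tangent_space \<A> p. \<forall>a b.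
        A p (tlincomb a v b w) = tlincomb a (A p v) b (A p w)) \<and>
     (\<forall>X \<in> vector_fields \<A>. (\<lambda>p. A p (X p)) \<in> vector_fields \<A>)"

definition riemannian_metric ::
    "('m::{t2_space, second_countable_topology}, 'e::euclidean_space) atlas \<Rightarrow> 'm tensor02 \<Rightarrow> bool" where
  "riemannian_metric \<A> g \<longleftrightarrow> tensor_field02 \<A> g \<and>
     (\<forall>p. \<forall>v \<in> tangent_space \<A> p. \<forall>w \<in> tangent_space \<A> p. g p v w = g p w v) \<and>
     (\<forall>p. \<forall>v \<in> tangent_space \<A> p. v \<noteq> (\<lambda>f. 0) \<longrightarrow> 0 < g p v v)"

definition almost_hermitian_manifold ::
    "('m::{t2_space, second_countable_topology}, 'e::euclidean_space) atlas
       \<Rightarrow> 'm tensor02 \<Rightarrow> 'm tensor11 \<Rightarrow> bool" where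
  "almost_hermitian_manifold \<A> g A \<longleftrightarrow>
     smooth_manifold \<A> \<and> even DIM('e) \<and> 4 \<le> DIM('e) \<and>
     riemannian_metric \<A> g \<and> tensor_field11 \<A> A \<and>
     (\<forall>p. \<forall>v \<in> tangent_space \<A> p. A p (A p v) = (\<lambda>f. - v f)) \<and>
     (\<forall>p. \<forall>v \<in> tangent_space \<A> p. \<forall>w \<in> tangent_space \<A> p. g p (A p v) (A p w) = g p v w)"

definition kaehler_form :: "'m tensor02 \<Rightarrow> 'm tensor11 \<Rightarrow> 'm tensor02" where
  "kaehler_form g A = (\<lambda>p v w. g p (A p v) w)"

definition generalized_metric :: "'m tensor02 \<Rightarrow> 'm tensor11 \<Rightarrow> 'm tensor02" where
  "generalized_metric g A = (\<lambda>p v w. g p v w + kaehler_form g A p v w)"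

text \<open>Throughout, \<open>D X Y\<close> is the covariant derivative of \<open>Y\<close> in the direction of \<open>X\<close>.\<close>

type_synonym 'm connection = "'m vfield \<Rightarrow> 'm vfield \<Rightarrow> 'm vfield"

definition affine_connection ::
    "('m::{t2_space, second_countable_topology}, 'e::euclidean_space) atlas \<Rightarrow> 'm connection \<Rightarrow> bool" where
  "affine_connection \<A> D \<longleftrightarrow>
     (\<forall>X \<in> vector_fields \<A>. \<forall>Y \<in> vector_fields \<A>. D X Y \<in> vector_fields \<A>) \<and>
     (\<forall>X \<in> vector_fields \<A>. \<forall>Y \<in> vector_fields \<A>. \<forall>Z \<in> vector_fields \<A>.
        D (vf_add X Y) Z = vf_add (D X Z) (D Y Z) \<and>
        D X (vf_add Y Z) = vf_add (D X Y) (D X Z)) \<and>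
     (\<forall>f \<in> smooth_functions \<A>. \<forall>X \<in> vector_fields \<A>. \<forall>Y \<in> vector_fields \<A>.
        D (vf_scale f X) Y = vf_scale f (D X Y) \<and>
        D X (vf_scale f Y) = vf_add (vf_scale f (D X Y)) (vf_scale (\<lambda>p. X p f) Y))"

definition cov_deriv02 ::
    "'m connection \<Rightarrow> 'm tensor02 \<Rightarrow> 'm vfield \<Rightarrow> 'm vfield \<Rightarrow> 'm vfield \<Rightarrow> 'm \<Rightarrow> real" where
  "cov_deriv02 D T X Y Z = (\<lambda>p.
     X p (\<lambda>q. T q (Y q) (Z q)) - T p (D X Y p) (Z p) - T p (Y p) (D X Z p))"

definition cov_deriv11 :: "'m connection \<Rightarrow> 'm tensor11 \<Rightarrow> 'm vfield \<Rightarrow> 'm vfield \<Rightarrow> 'm vfield" where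
  "cov_deriv11 D A X Y = (\<lambda>p f. D X (\<lambda>q. A q (Y q)) p f - A p (D X Y p) f)"

definition parallel02 ::
    "('m::{t2_space, second_countable_topology}, 'e::euclidean_space) atlas
       \<Rightarrow> 'm connection \<Rightarrow> 'm tensor02 \<Rightarrow> bool" where
  "parallel02 \<A> D T \<longleftrightarrow>
     (\<forall>X \<in> vector_fields \<A>. \<forall>Y \<in> vector_fields \<A>. \<forall>Z \<in> vector_fields \<A>.
        cov_deriv02 D T X Y Z = (\<lambda>p. 0))"

definition parallel11 ::
    "('m::{t2_space, second_countable_topology}, 'e::euclidean_space) atlas
       \<Rightarrow> 'm connection \<Rightarrow> 'm tensor11 \<Rightarrow> bool" where
  "parallel11 \<A> D A \<longleftrightarrow>
     (\<forall>X \<in> vector_fields \<A>. \<forall>Y \<in> vector_fields \<A>. cov_deriv11 D A X Y = (\<lambda>p f. 0))"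

definition torsion_free ::
    "('m::{t2_space, second_countable_topology}, 'e::euclidean_space) atlas \<Rightarrow> 'm connection \<Rightarrow> bool" where
  "torsion_free \<A> D \<longleftrightarrow>
     (\<forall>X \<in> vector_fields \<A>. \<forall>Y \<in> vector_fields \<A>. \<forall>p f.
        D X Y p f - D Y X p f - lie_bracket X Y p f = 0)"

definition levi_civita_connection ::
    "('m::{t2_space, second_countable_topology}, 'e::euclidean_space) atlas
       \<Rightarrow> 'm tensor02 \<Rightarrow> 'm connection \<Rightarrow> bool" where
  "levi_civita_connection \<A> g D \<longleftrightarrow>
     affine_connection \<A> D \<and> torsion_free \<A> D \<and> parallel02 \<A> D g"

text \<open>
  The Levi-Civita connection is unique as a map on smooth vector fields, so the existential
  quantifier in \<open>kaehler_manifold\<close> below does not introduce a choice.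
\<close>

lemma levi_civita_connection_unique:
  assumes g: "riemannian_metric \<A> g"
    and D: "levi_civita_connection \<A> g D" and E: "levi_civita_connection \<A> g E"
    and X: "X \<in> vector_fields \<A>" and Y: "Y \<in> vector_fields \<A>"
  shows "D X Y = E X Y"
proof
  fix p
  define S where "S X Y Z = g p (D X Y p) (Z p) - g p (E X Y p) (Z p)" for X Y Z
  have cl: "D X Y \<in> vector_fields \<A>" "E X Y \<in> vector_fields \<A>"
    if "X \<in> vector_fields \<A>" "Y \<in> vector_fields \<A>" for X Y
    using D E that by (auto simp: levi_civita_connection_def affine_connection_def)
  have tv: "X p \<in> tangent_space \<A> p" if "X \<in> vector_fields \<A>" for X
    using that by (auto simp: vector_fields_def)
  have lin: "g p (tlincomb a u b v) w = a * g p u w + b * g p v w"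
    "g p w (tlincomb a u b v) = a * g p w u + b * g p w v"
    if "u \<in> tangent_space \<A> p" "v \<in> tangent_space \<A> p" "w \<in> tangent_space \<A> p" for a b u v w
    using g that unfolding riemannian_metric_def tensor_field02_def by blast+
  have sym: "g p u v = g p v u" if "u \<in> tangent_space \<A> p" "v \<in> tangent_space \<A> p" for u v
    using g that unfolding riemannian_metric_def by blast
  have tor: "S X Y Z = S Y X Z"
    if "X \<in> vector_fields \<A>" "Y \<in> vector_fields \<A>" "Z \<in> vector_fields \<A>" for X Y Z
  proof -
    have "D X Y p f - D Y X p f = lie_bracket X Y p f"
      "E X Y p f - E Y X p f = lie_bracket X Y p f" for f
      using D E that unfolding levi_civita_connection_def torsion_free_def by fastforce+
    then have "tlincomb 1 (D X Y p) (-1) (D Y X p) = tlincomb 1 (E X Y p) (-1) (E Y X p)"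
      unfolding tlincomb_def by auto
    then have "g p (tlincomb 1 (D X Y p) (-1) (D Y X p)) (Z p)
        = g p (tlincomb 1 (E X Y p) (-1) (E Y X p)) (Z p)" by simp
    then show ?thesis
      by (simp add: lin tv cl that S_def)
  qed
  have met: "S X Y Z = - S X Z Y"
    if "X \<in> vector_fields \<A>" "Y \<in> vector_fields \<A>" "Z \<in> vector_fields \<A>" for X Y Z
  proof -
    have "cov_deriv02 D g X Y Z p = cov_deriv02 E g X Y Z p"
      using D E that by (simp add: levi_civita_connection_def parallel02_def)
    then show ?thesis
      using sym[of "Y p" "D X Z p"] sym[of "Y p" "E X Z p"]
      by (simp add: cov_deriv02_def S_def tv cl that)
  qed
  have S0: "S X Y Z = 0"
    if h: "X \<in> vector_fields \<A>" "Y \<in> vector_fields \<A>" "Z \<in> vector_fields \<A>" for X Y Z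
    using tor[of X Y Z] met[of Y X Z] tor[of Y Z X] met[of Z Y X] tor[of Z X Y] met[of X Z Y] h
    by linarith
  let ?v = "D X Y p" and ?w = "E X Y p"
  have vw: "?v \<in> tangent_space \<A> p" "?w \<in> tangent_space \<A> p"
    using cl tv X Y by auto
  have "g p ?v ?v - g p ?w ?v = 0" "g p ?v ?w - g p ?w ?w = 0"
    using S0[OF X Y cl(1)[OF X Y]] S0[OF X Y cl(2)[OF X Y]] by (simp_all add: S_def)
  moreover have u: "tlincomb 1 ?v (-1) ?w \<in> tangent_space \<A> p"
    using vw by (simp add: tangent_space_def tlincomb_def algebra_simps)
  ultimately have "g p (tlincomb 1 ?v (-1) ?w) (tlincomb 1 ?v (-1) ?w) = 0"
    using vw by (simp add: lin)
  then have "tlincomb 1 ?v (-1) ?w = (\<lambda>f. 0)"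
    using g u unfolding riemannian_metric_def by (metis less_irrefl)
  then show "?v = ?w"
    by (auto simp: tlincomb_def fun_eq_iff)
qed

definition kaehler_manifold ::
    "('m::{t2_space, second_countable_topology}, 'e::euclidean_space) atlas
       \<Rightarrow> 'm tensor02 \<Rightarrow> 'm tensor11 \<Rightarrow> bool" where
  "kaehler_manifold \<A> g A \<longleftrightarrow> almost_hermitian_manifold \<A> g A \<and>
     (\<exists>D. levi_civita_connection \<A> g D \<and> parallel11 \<A> D A)"

definition quarter_symmetric_connection ::
    "'m connection \<Rightarrow> 'm form1 \<Rightarrow> 'm tensor11 \<Rightarrow> 'm connection" where
  "quarter_symmetric_connection D \<pi> A X Y = (\<lambda>p f. D X Y p f - \<pi> p (X p) * A p (Y p) f)"

end

theory Submission
  imports Defs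
begin

text \<open>
  Since \<open>A\<close> is a \<open>g\<close>-isometry with square \<open>-1\<close>, it is \<open>g\<close>-skew, and hence
  \<open>G (A Y) Z + G Y (A Z) = 0\<close>: the correction term \<open>\<pi>(X) A Y\<close> does not affect the derivative
  of \<open>G\<close>.  So the Levi-Civita connection preserves \<open>G\<close> and \<open>g\<close>, therefore also \<open>F = G - g\<close>,
  and \<open>(\<nabla>\<^sub>X F)(Y, Z) = g ((\<nabla>\<^sub>X A) Y, Z)\<close> with \<open>g\<close> definite.
\<close>

lemma tlincomb_in_tangent_space:
  assumes "u \<in> tangent_space \<A> p" "v \<in> tangent_space \<A> p"
  shows "tlincomb a u b v \<in> tangent_space \<A> p"
  using assms by (simp add: tangent_space_def tlincomb_def algebra_simps)

lemma vector_field_at: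
  "X \<in> vector_fields \<A> \<Longrightarrow> X p \<in> tangent_space \<A> p"
  by (simp add: vector_fields_def)

text \<open>Tangent vectors take the value 0 on non-smooth functions, so additivity can fail unless
  both summands are smooth.\<close>

lemma tangent_vector_add:
  assumes "v \<in> tangent_space \<A> p" "f \<in> smooth_functions \<A>" "h \<in> smooth_functions \<A>"
  shows "v (\<lambda>x. f x + h x) = v f + v h"
proof -
  have "v (\<lambda>x. 1 * f x + 1 * h x) = 1 * v f + 1 * v h"
    using assms unfolding tangent_space_def by blast
  then show ?thesis by simp
qed

lemma tensor_field02_tlincomb:
  assumes "tensor_field02 \<A> T"
    and "u \<in> tangent_space \<A> p" "v \<in> tangent_space \<A> p" "w \<in> tangent_space \<A> p"
  shows "T p (tlincomb a u b v) w = a * T p u w + b * T p v w"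
    and "T p w (tlincomb a u b v) = a * T p w u + b * T p w v"
  using assms unfolding tensor_field02_def by blast+

lemma almost_hermitian_skew:
  assumes H: "almost_hermitian_manifold \<A> g A"
    and v: "v \<in> tangent_space \<A> p" and w: "w \<in> tangent_space \<A> p"
  shows "g p (A p v) w = - g p v (A p w)" and "g p (A p (A p v)) w = - g p v w"
proof -
  have g: "tensor_field02 \<A> g" and T: "\<And>u. u \<in> tangent_space \<A> p \<Longrightarrow> A p u \<in> tangent_space \<A> p"
    using H by (auto simp: almost_hermitian_manifold_def riemannian_metric_def tensor_field11_def)
  \<comment> \<open>The minus sign is recast as a \<open>tlincomb\<close>, the only form for which
    linearity of \<open>g\<close> is stated.\<close>
  have "A p (A p v) = tlincomb (-1) v 0 v"
    using H v by (simp add: almost_hermitian_manifold_def tlincomb_def)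
  then have sq: "g p (A p (A p v)) u = - g p v u" if "u \<in> tangent_space \<A> p" for u
    using tensor_field02_tlincomb(1)[OF g v v that, of "-1" 0] by simp
  show "g p (A p (A p v)) w = - g p v w" using sq[OF w] .
  \<comment> \<open>The isometry condition is used for the pair \<open>A p v\<close>,
    \<open>w\<close>; \<open>sq\<close> at \<open>A p w\<close> then turns it into skewness.\<close>
  have "g p (A p (A p v)) (A p w) = g p (A p v) w"
    using H T[OF v] w unfolding almost_hermitian_manifold_def by blast
  then show "g p (A p v) w = - g p v (A p w)" using sq[OF T[OF w]] by simp
qed

lemma tensor_field02_kaehler_form:
  assumes "almost_hermitian_manifold \<A> g A"
  shows "tensor_field02 \<A> (kaehler_form g A)"
proof -
  have "tensor_field11 \<A> A" and g: "tensor_field02 \<A> g"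
    using assms by (auto simp: almost_hermitian_manifold_def riemannian_metric_def)
  then show ?thesis
    unfolding tensor_field02_def[of _ "kaehler_form g A"] kaehler_form_def
    by (simp add: tensor_field11_def tensor_field02_tlincomb[OF g])
      (simp add: tensor_field02_def)
qed

text \<open>Changing the connection adds \<pi>(X) (G(AY, Z) + G(Y, AZ)). In the bracket, g(AY, Z)
  cancels g(Y, AZ) by skewness, and F(AY, Z) = -g(Y, Z) cancels F(Y, AZ) = g(AY, AZ) = g(Y,
  Z).\<close>

lemma cov_deriv02_quarter_symmetric_generalized_metric:
  assumes H: "almost_hermitian_manifold \<A> g A" and D: "affine_connection \<A> D"
    and X: "X \<in> vector_fields \<A>" and Y: "Y \<in> vector_fields \<A>" and Z: "Z \<in> vector_fields \<A>"
  shows "cov_deriv02 (quarter_symmetric_connection D \<pi> A) (generalized_metric g A) X Y Z p =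
    cov_deriv02 D g X Y Z p + cov_deriv02 D (kaehler_form g A) X Y Z p"
proof -
  have g: "tensor_field02 \<A> g" and A: "tensor_field11 \<A> A"
    and iso: "g p (A p (Y p)) (A p (Z p)) = g p (Y p) (Z p)"
    using H vector_field_at[OF Y, of p] vector_field_at[OF Z, of p]
    by (auto simp: almost_hermitian_manifold_def riemannian_metric_def)
  note F = tensor_field02_kaehler_form[OF H]
  have tv: "Y p \<in> tangent_space \<A> p" "Z p \<in> tangent_space \<A> p"
    "D X Y p \<in> tangent_space \<A> p" "D X Z p \<in> tangent_space \<A> p"
    using D X Y Z by (auto simp: affine_connection_def intro!: vector_field_at)
  then have Atv: "A p (Y p) \<in> tangent_space \<A> p" "A p (Z p) \<in> tangent_space \<A> p"
    using A by (auto simp: tensor_field11_def)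
  have qs: "quarter_symmetric_connection D \<pi> A X W p =
      tlincomb 1 (D X W p) (- \<pi> p (X p)) (A p (W p))" for W
    by (simp add: quarter_symmetric_connection_def tlincomb_def)
  have "X p (\<lambda>q. generalized_metric g A q (Y q) (Z q)) =
      X p (\<lambda>q. g q (Y q) (Z q)) + X p (\<lambda>q. kaehler_form g A q (Y q) (Z q))"
    unfolding generalized_metric_def
    using g F Y Z by (intro tangent_vector_add[OF vector_field_at[OF X]])
      (simp_all add: tensor_field02_def)
  moreover have "g p (A p (A p (Y p))) (Z p) = - g p (Y p) (Z p)"
    "g p (A p (Y p)) (Z p) = - g p (Y p) (A p (Z p))"
    using almost_hermitian_skew[OF H] tv by blast+
  then have "generalized_metric g A p (A p (Y p)) (Z p) +
      generalized_metric g A p (Y p) (A p (Z p)) = 0"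
    using iso by (simp add: generalized_metric_def kaehler_form_def)
  \<comment> \<open>Scaled by \<pi>(X) in advance: this product is exactly what remains after the
    bilinear expansion below.\<close>
  then have "\<pi> p (X p) * (generalized_metric g A p (A p (Y p)) (Z p) +
      generalized_metric g A p (Y p) (A p (Z p))) = 0"
    by simp
  ultimately show ?thesis
    using tv Atv
    by (simp add: cov_deriv02_def qs generalized_metric_def tensor_field02_tlincomb[OF g]
        tensor_field02_tlincomb[OF F] algebra_simps)
qed

text \<open>Metric compatibility for the pair AY, Z replaces X(g(AY, Z)) by g(D_X(AY), Z) + g(AY,
  D_X Z). The last term cancels in the derivative of F, leaving g(D_X(AY) - A(D_X Y), Z).\<close>

lemma cov_deriv02_kaehler_form:
  assumes H: "almost_hermitian_manifold \<A> g A"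
    and D: "affine_connection \<A> D" and par: "parallel02 \<A> D g"
    and X: "X \<in> vector_fields \<A>" and Y: "Y \<in> vector_fields \<A>" and Z: "Z \<in> vector_fields \<A>"
  shows "cov_deriv02 D (kaehler_form g A) X Y Z p = g p (cov_deriv11 D A X Y p) (Z p)"
proof -
  have g: "tensor_field02 \<A> g" and A: "tensor_field11 \<A> A"
    using H by (auto simp: almost_hermitian_manifold_def riemannian_metric_def)
  have AY: "(\<lambda>q. A q (Y q)) \<in> vector_fields \<A>"
    using A Y by (simp add: tensor_field11_def)
  have tv: "D X (\<lambda>q. A q (Y q)) p \<in> tangent_space \<A> p" "A p (D X Y p) \<in> tangent_space \<A> p"
    using A D X Y AY by (auto simp: affine_connection_def tensor_field11_def vector_field_at)
  have "cov_deriv02 D g X (\<lambda>q. A q (Y q)) Z p = 0"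
    using par X AY Z by (simp add: parallel02_def)
  moreover have "cov_deriv11 D A X Y p =
      tlincomb 1 (D X (\<lambda>q. A q (Y q)) p) (-1) (A p (D X Y p))"
    by (simp add: cov_deriv11_def tlincomb_def)
  ultimately show ?thesis
    using tv vector_field_at[OF Z]
    by (simp add: cov_deriv02_def kaehler_form_def tensor_field02_tlincomb[OF g])
qed

lemma parallel_structure_if_parallel_kaehler_form:
  assumes H: "almost_hermitian_manifold \<A> g A" and D: "levi_civita_connection \<A> g D"
    and F: "parallel02 \<A> D (kaehler_form g A)"
  shows "parallel11 \<A> D A"
  unfolding parallel11_def
proof (intro ballI ext)
  fix X Y p f
  assume X: "X \<in> vector_fields \<A>" and Y: "Y \<in> vector_fields \<A>"
  have g: "riemannian_metric \<A> g" and A: "tensor_field11 \<A> A"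
    using H by (auto simp: almost_hermitian_manifold_def)
  have cl: "D X W \<in> vector_fields \<A>" if "W \<in> vector_fields \<A>" for W
    using D X that by (simp add: levi_civita_connection_def affine_connection_def)
  \<comment> \<open>Orthogonality will be known only against values of smooth vector fields. Both
    \<open>?U\<close> and \<open>?V\<close> are such fields, and their difference at
    \<open>p\<close> is the derivative of \<open>A\<close> itself, which is therefore orthogonal to
    itself.\<close>
  let ?U = "D X (\<lambda>q. A q (Y q))" and ?V = "\<lambda>q. A q (D X Y q)"
  have UV: "?U \<in> vector_fields \<A>" "?V \<in> vector_fields \<A>"
    using A Y cl by (simp_all add: tensor_field11_def)
  have eq: "cov_deriv11 D A X Y p = tlincomb 1 (?U p) (-1) (?V p)"
    by (simp add: cov_deriv11_def tlincomb_def)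
  have orth: "g p (cov_deriv11 D A X Y p) (W p) = 0" if "W \<in> vector_fields \<A>" for W
  proof -
    have "cov_deriv02 D (kaehler_form g A) X Y W p = 0"
      using F X Y that by (simp add: parallel02_def)
    then show ?thesis
      using cov_deriv02_kaehler_form[OF H _ _ X Y that, of D p] D
      by (simp add: levi_civita_connection_def)
  qed
  have T: "cov_deriv11 D A X Y p \<in> tangent_space \<A> p"
    unfolding eq by (intro tlincomb_in_tangent_space vector_field_at UV)
  have "g p (cov_deriv11 D A X Y p) (tlincomb 1 (?U p) (-1) (?V p)) =
      1 * g p (cov_deriv11 D A X Y p) (?U p) + (-1) * g p (cov_deriv11 D A X Y p) (?V p)"
    using g by (intro tensor_field02_tlincomb(2)[OF _ vector_field_at[OF UV(1)]
          vector_field_at[OF UV(2)] T]) (simp add: riemannian_metric_def)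
  then have "g p (cov_deriv11 D A X Y p) (cov_deriv11 D A X Y p) = 0"
    using orth[OF UV(1)] orth[OF UV(2)] by (simp flip: eq)
  then have "cov_deriv11 D A X Y p = (\<lambda>f. 0)"
    using g T unfolding riemannian_metric_def by (metis less_irrefl)
  then show "cov_deriv11 D A X Y p f = 0"
    by simp
qed

theorem theorem3p2:
  fixes \<A> :: "('m::{t2_space, second_countable_topology}, 'e::euclidean_space) atlas"
    and g :: "'m tensor02" and A :: "'m tensor11"
    and D :: "'m connection" and \<pi> :: "'m form1"
  assumes "almost_hermitian_manifold \<A> g A"
    and "levi_civita_connection \<A> g D"
    and "one_form \<A> \<pi>"
    and "parallel02 \<A> (quarter_symmetric_connection D \<pi> A) (generalized_metric g A)"
  shows "kaehler_manifold \<A> g A"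
proof -
  have D: "affine_connection \<A> D" "parallel02 \<A> D g"
    using assms(2) by (simp_all add: levi_civita_connection_def)
  have "parallel02 \<A> D (kaehler_form g A)"
    unfolding parallel02_def
  proof (intro ballI ext)
    fix X Y Z p
    assume XYZ: "X \<in> vector_fields \<A>" "Y \<in> vector_fields \<A>" "Z \<in> vector_fields \<A>"
    \<comment> \<open>The derivative of G under the new connection and that of g under
      \<open>D\<close> both vanish, so the remaining summand does too.\<close>
    show "cov_deriv02 D (kaehler_form g A) X Y Z p = 0"
      using cov_deriv02_quarter_symmetric_generalized_metric[OF assms(1) D(1) XYZ, of \<pi> p]
        assms(4) D(2) XYZ
      by (simp add: parallel02_def)
  qed
  then show ?thesis
    using parallel_structure_if_parallel_kaehler_form assms(1,2)
    unfolding kaehler_manifold_def by blast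
qed

end
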